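(* Let $\alpha\in\mathbb Z\setminus\{-1,0\}$ and let $(h_n)$ be the sequence with $h_0=0$, $h_1=1$, $h_2=-\alpha(\alpha+1)$, $h_3=-\alpha^3(\alpha+1)^3$, $h_4=\alpha^6(\alpha+1)^5$, and for $m\ge2$: $h_{2m+1}=h_{m+2}h_m^3-h_{m-1}h_{m+1}^3$, for $m\ge 3$: $h_{2m}=h_m\big(h_{m+2}h_{m-1}^2-h_{m-2}h_{m+1}^2\big)/h_2$. (i) If $n\equiv 1,5,7,11\pmod{12}$, then $h_n$ is a square. (ii) If $n\equiv 1,3,9,15,17\pmod{18}$, then $h_n$ is a cube.
   Context: The sequence defined is the elliptic divisibility sequence attached to the point $(0,0)$ of order $6$ on the Tate normal form curve with $b=\alpha+\alpha^2$, $c=\alpha$; its sixth term is zero. Convention: an integer $m$ is called a square if $m=\pm\beta^2$ for some nonzero integer $\beta$, and a cube if $m=\beta^3$ for some nonzero integer $\beta$. *)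

theory Defs
  imports Complex_Main
begin

text \<open>Both signs are allowed for squares, and zero counts neither as a square nor as a cube.\<close>

definition is_signed_square :: "int \<Rightarrow> bool" where
  "is_signed_square m \<longleftrightarrow> (\<exists>\<beta>::int. \<beta> \<noteq> 0 \<and> (m = \<beta> ^ 2 \<or> m = - (\<beta> ^ 2)))"

definition is_nonzero_cube :: "int \<Rightarrow> bool" where
  "is_nonzero_cube m \<longleftrightarrow> (\<exists>\<beta>::int. \<beta> \<noteq> 0 \<and> m = \<beta> ^ 3)"

end

theory Submission
  imports Defs
begin

text \<open>
  Put a = -\<alpha>^5 (\<alpha> + 1)^4. The sequence is quasi-periodic with period 6:
  h (6k + j) = (-1)^k a^(3k^2 + kj) h j for all j. Both recurrences are homogeneous of degree
  four and compatible with this scaling, so once the right-hand side is taken as the definition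
  of a candidate sequence they need only be checked for six consecutive values of m.
  Squares and cubes are then read off from the exponents.
\<close>

section \<open>The candidate sequence and its quasi-periodicity\<close>

fun tate6_initial :: "int \<Rightarrow> nat \<Rightarrow> int" where
  "tate6_initial x r =
     (if r = 1 then 1
      else if r = 2 then - x * (x + 1)
      else if r = 3 then - (x ^ 3) * (x + 1) ^ 3
      else if r = 4 then x ^ 6 * (x + 1) ^ 5
      else if r = 5 then x ^ 10 * (x + 1) ^ 8
      else 0)"

text \<open>This is (h_8/h_2)/(h_7/h_1): raising j by one multiplies the change over one period by
  it.\<close>

definition tate6_multiplier :: "int \<Rightarrow> int" where
  "tate6_multiplier x = - (x ^ 5 * (x + 1) ^ 4)"

definition tate6_factor :: "int \<Rightarrow> nat \<Rightarrow> nat \<Rightarrow> int" where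
  "tate6_factor x k j = (- 1) ^ k * tate6_multiplier x ^ (3 * k\<^sup>2 + k * j)"

definition tate6_eds :: "int \<Rightarrow> nat \<Rightarrow> int" where
  "tate6_eds x n = tate6_factor x (n div 6) (n mod 6) * tate6_initial x (n mod 6)"

text \<open>The cross term 6*k*q of 3*(k + q)^2 is exactly what 6*q contributes in the second
  argument. This cocycle rule extends quasi-periodicity from j < 6 to every j.\<close>

lemma tate6_factor_add:
  "tate6_factor x (k + q) r = tate6_factor x k (6 * q + r) * tate6_factor x q r"
proof -
  have "3 * (k + q)\<^sup>2 + (k + q) * r = (3 * k\<^sup>2 + k * (6 * q + r)) + (3 * q\<^sup>2 + q * r)"
    by (simp add: power2_eq_square algebra_simps)
  then show ?thesis
    by (simp only: tate6_factor_def power_add mult_ac)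
qed

lemma tate6_eds_quasi_periodic:
  "tate6_eds x (6 * k + j) = tate6_factor x k j * tate6_eds x j"
proof -
  have "(6 * k + j) div 6 = k + j div 6" "(6 * k + j) mod 6 = j mod 6"
    by simp_all
  then show ?thesis
    using tate6_factor_add[of x k "j div 6" "j mod 6"]
    by (simp add: tate6_eds_def del: tate6_initial.simps)
qed

text \<open>The exponent is linear in the second argument, so the scalings of terms near index 6*k +
  r differ only by powers of one number.\<close>

lemma tate6_factor_shift:
  "tate6_factor x k (r + i) = tate6_factor x k r * (tate6_multiplier x ^ k) ^ i"
  by (simp add: tate6_factor_def power_add distrib_left flip: power_mult)

text \<open>3*k^2 + k*r is a quadratic form in (k, r), so doubling both arguments multiplies it by
  4, and both signs become 1. Index doubling thus matches the degree four of the
  recurrences.\<close>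

lemma tate6_factor_double:
  "tate6_factor x (2 * k) (2 * r) = tate6_factor x k r ^ 4"
proof -
  have "3 * (2 * k)\<^sup>2 + (2 * k) * (2 * r) = (3 * k\<^sup>2 + k * r) * 4"
    by (simp add: power2_eq_square algebra_simps)
  moreover have "((- 1 :: int) ^ k) ^ 4 = 1"
    by (simp flip: power_mult add: mult.commute[of k])
  ultimately show ?thesis
    by (simp only: tate6_factor_def power_mult_distrib power_mult[symmetric]) (simp add: power_mult)
qed

section \<open>Both recurrences for the candidate\<close>

lemma residue_mod6_from_two:
  fixes m :: nat
  assumes "m \<ge> 2"
  obtains k r where "m = 6 * k + Suc (Suc r)" and "r \<in> {0, 1, 2, 3, 4, 5}"
proof
  \<comment> \<open>With r the residue of m - 2, the offsets of m - 2 and m - 1 are r and r + 1, so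
    the base cases contain no truncated subtraction.\<close>
  show "m = 6 * ((m - 2) div 6) + Suc (Suc ((m - 2) mod 6))"
    using assms by simp
  have "(m - 2) mod 6 < 6"
    by simp
  then show "(m - 2) mod 6 \<in> {0, 1, 2, 3, 4, 5}"
    unfolding insert_iff by linarith
qed

text \<open>Naming x + 1 as y keeps every value a monomial. Indices up to 15 serve the base cases of
  the recurrences, and 17 serves the cubes.\<close>

lemma tate6_eds_values:
  fixes x y :: int
  assumes "y = x + 1"
  shows "tate6_eds x 0 = 0" "tate6_eds x 1 = 1" "tate6_eds x 2 = - (x * y)"
    "tate6_eds x 3 = - (x ^ 3 * y ^ 3)" "tate6_eds x 4 = x ^ 6 * y ^ 5"
    "tate6_eds x 5 = x ^ 10 * y ^ 8" "tate6_eds x 6 = 0" "tate6_eds x 7 = - (x ^ 20 * y ^ 16)"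
    "tate6_eds x 8 = - (x ^ 26 * y ^ 21)" "tate6_eds x 9 = x ^ 33 * y ^ 27"
    "tate6_eds x 10 = x ^ 41 * y ^ 33" "tate6_eds x 11 = - (x ^ 50 * y ^ 40)"
    "tate6_eds x 12 = 0" "tate6_eds x 13 = x ^ 70 * y ^ 56" "tate6_eds x 14 = - (x ^ 81 * y ^ 65)"
    "tate6_eds x 15 = - (x ^ 93 * y ^ 75)" "tate6_eds x 17 = x ^ 120 * y ^ 96"
  unfolding tate6_eds_def tate6_factor_def tate6_multiplier_def tate6_initial.simps assms[symmetric]
  by (simp_all add: power_mult_distrib flip: power_mult) algebra+

lemma tate6_eds_odd_base:
  assumes "r \<in> {0, 1, 2, 3, 4, 5}"
  shows "tate6_eds x (2 * r + 5) =
    tate6_eds x (r + 4) * tate6_eds x (r + 2) ^ 3 - tate6_eds x (r + 1) * tate6_eds x (r + 3) ^ 3"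
proof -
  define y where "y = x + 1"
  \<comment> \<open>Only indices 5 and 7 combine two surviving monomials, x^9*y^9 - x^9*y^8 and
    x^19*y^16 - x^19*y^17; they merge by y - 1 = x.\<close>
  have y9: "y ^ 9 = y ^ 8 * (x + 1)" and y17: "y ^ 17 = y ^ 16 * (x + 1)"
    by (simp_all add: numeral_eq_Suc flip: y_def)
  have "tate6_eds x 5 = tate6_eds x 4 * tate6_eds x 2 ^ 3 - tate6_eds x 1 * tate6_eds x 3 ^ 3"
    unfolding tate6_eds_values[OF y_def] using y9 by algebra
  moreover have "tate6_eds x 7 = tate6_eds x 5 * tate6_eds x 3 ^ 3 - tate6_eds x 2 * tate6_eds x 4 ^ 3"
    unfolding tate6_eds_values[OF y_def] using y17 by algebra
  \<comment> \<open>In these four cases one product contains the vanishing term of index 6.\<close>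
  moreover have "tate6_eds x 9 = tate6_eds x 6 * tate6_eds x 4 ^ 3 - tate6_eds x 3 * tate6_eds x 5 ^ 3"
    "tate6_eds x 11 = tate6_eds x 7 * tate6_eds x 5 ^ 3 - tate6_eds x 4 * tate6_eds x 6 ^ 3"
    "tate6_eds x 13 = tate6_eds x 8 * tate6_eds x 6 ^ 3 - tate6_eds x 5 * tate6_eds x 7 ^ 3"
    "tate6_eds x 15 = tate6_eds x 9 * tate6_eds x 7 ^ 3 - tate6_eds x 6 * tate6_eds x 8 ^ 3"
    unfolding tate6_eds_values[OF y_def]
    by (simp_all add: power_mult_distrib flip: power_mult) algebra+
  ultimately show ?thesis
    using assms by (auto simp del: One_nat_def add_2_eq_Suc add_2_eq_Suc')
qed

lemma tate6_eds_even_base: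
  assumes "r \<in> {0, 1, 2, 3, 4, 5}"
  shows "tate6_eds x 2 * tate6_eds x (2 * r + 4) = tate6_eds x (r + 2) *
    (tate6_eds x (r + 4) * tate6_eds x (r + 1) ^ 2 - tate6_eds x r * tate6_eds x (r + 3) ^ 2)"
proof -
  define y where "y = x + 1"
  \<comment> \<open>In the second equation both products in the bracket equal x^12*y^10 and cancel.
    In the others a term of index 0 or 6 kills one product or the whole right side.\<close>
  have "tate6_eds x 2 * tate6_eds x 4 = tate6_eds x 2 * (tate6_eds x 4 * tate6_eds x 1 ^ 2 - tate6_eds x 0 * tate6_eds x 3 ^ 2)"
    "tate6_eds x 2 * tate6_eds x 6 = tate6_eds x 3 * (tate6_eds x 5 * tate6_eds x 2 ^ 2 - tate6_eds x 1 * tate6_eds x 4 ^ 2)"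
    "tate6_eds x 2 * tate6_eds x 8 = tate6_eds x 4 * (tate6_eds x 6 * tate6_eds x 3 ^ 2 - tate6_eds x 2 * tate6_eds x 5 ^ 2)"
    "tate6_eds x 2 * tate6_eds x 10 = tate6_eds x 5 * (tate6_eds x 7 * tate6_eds x 4 ^ 2 - tate6_eds x 3 * tate6_eds x 6 ^ 2)"
    "tate6_eds x 2 * tate6_eds x 12 = tate6_eds x 6 * (tate6_eds x 8 * tate6_eds x 5 ^ 2 - tate6_eds x 4 * tate6_eds x 7 ^ 2)"
    "tate6_eds x 2 * tate6_eds x 14 = tate6_eds x 7 * (tate6_eds x 9 * tate6_eds x 6 ^ 2 - tate6_eds x 5 * tate6_eds x 8 ^ 2)"
    unfolding tate6_eds_values[OF y_def]
    by (simp_all add: power_mult_distrib flip: power_mult) algebra+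
  then show ?thesis
    using assms by (auto simp del: One_nat_def add_2_eq_Suc add_2_eq_Suc')
qed

lemma tate6_eds_odd:
  assumes "m \<ge> 2"
  shows "tate6_eds x (2 * m + 1) =
    tate6_eds x (m + 2) * tate6_eds x m ^ 3 - tate6_eds x (m - 1) * tate6_eds x (m + 1) ^ 3"
proof -
  obtain k r where m: "m = 6 * k + Suc (Suc r)" and r: "r \<in> {0, 1, 2, 3, 4, 5}"
    using residue_mod6_from_two[OF assms] .
  define F u where "F = tate6_factor x k r" and "u = tate6_multiplier x ^ k"
  have shift: "tate6_eds x (6 * k + (r + i)) = F * u ^ i * tate6_eds x (r + i)" for i
    by (simp only: tate6_eds_quasi_periodic tate6_factor_shift F_def u_def)
  \<comment> \<open>Both products on the right carry u to the power 4 + 3*2 = 1 + 3*3 = 10; index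
    2*m + 1 gives the same as (u^2)^5.\<close>
  have double: "tate6_eds x (6 * (2 * k) + (2 * r + 5)) = F ^ 4 * u ^ 10 * tate6_eds x (2 * r + 5)"
    by (simp only: tate6_eds_quasi_periodic tate6_factor_shift tate6_factor_double F_def u_def
        power_mult[symmetric]) (simp add: mult.commute)
  have idx: "2 * m + 1 = 6 * (2 * k) + (2 * r + 5)" "m + 2 = 6 * k + (r + 4)"
    "m - 1 = 6 * k + (r + 1)" "m + 1 = 6 * k + (r + 3)" "m = 6 * k + (r + 2)"
    using m by simp_all
  show ?thesis
    \<comment> \<open>The bare m is rewritten last because it also occurs inside the other
      indices.\<close>
    unfolding idx(1-4) unfolding idx(5) shift double tate6_eds_odd_base[OF r]
    by algebra
qed

text \<open>Multiplying through by the term of index 2 avoids integer division. That term is a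
  constant and is not rescaled, so the scaling of degree four on the right must come from index 2*m
  alone.\<close>

lemma tate6_eds_even:
  assumes "m \<ge> 2"
  shows "tate6_eds x 2 * tate6_eds x (2 * m) = tate6_eds x m *
    (tate6_eds x (m + 2) * tate6_eds x (m - 1) ^ 2 - tate6_eds x (m - 2) * tate6_eds x (m + 1) ^ 2)"
proof -
  obtain k r where m: "m = 6 * k + Suc (Suc r)" and r: "r \<in> {0, 1, 2, 3, 4, 5}"
    using residue_mod6_from_two[OF assms] .
  define F u where "F = tate6_factor x k r" and "u = tate6_multiplier x ^ k"
  have shift: "tate6_eds x (6 * k + (r + i)) = F * u ^ i * tate6_eds x (r + i)" for i
    by (simp only: tate6_eds_quasi_periodic tate6_factor_shift F_def u_def)
  \<comment> \<open>The weights are 2 + 4 + 2*1 = 2 + 0 + 2*3 = 8, matching (u^2)^4.\<close>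
  have double: "tate6_eds x (6 * (2 * k) + (2 * r + 4)) = F ^ 4 * u ^ 8 * tate6_eds x (2 * r + 4)"
    by (simp only: tate6_eds_quasi_periodic tate6_factor_shift tate6_factor_double F_def u_def
        power_mult[symmetric]) (simp add: mult.commute)
  have shift0: "tate6_eds x (6 * k + r) = F * tate6_eds x r"
    by (simp only: tate6_eds_quasi_periodic F_def)
  have idx: "2 * m = 6 * (2 * k) + (2 * r + 4)" "m + 2 = 6 * k + (r + 4)"
    "m - 1 = 6 * k + (r + 1)" "m - 2 = 6 * k + r" "m + 1 = 6 * k + (r + 3)"
    "m = 6 * k + (r + 2)"
    using m by simp_all
  show ?thesis
    unfolding idx(1-5) unfolding idx(6) shift shift0 double
    using tate6_eds_even_base[OF r, of x] by algebra
qed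

section \<open>Squares and cubes from the exponents\<close>

lemma tate6_multiplier_nonzero: "x \<noteq> 0 \<Longrightarrow> x \<noteq> - 1 \<Longrightarrow> tate6_multiplier x \<noteq> 0"
  by (simp add: tate6_multiplier_def)

lemma tate6_eds_signed_square:
  assumes x: "x \<noteq> 0" "x \<noteq> - 1" and n: "n mod 12 \<in> {1, 5, 7, 11}"
  shows "is_signed_square (tate6_eds x n)"
proof -
  define k r where "k = n div 6" and "r = n mod 6"
  have "n mod 12 mod 6 = r"
    by (simp add: r_def mod_mod_cancel)
  then have r: "r = 1 \<or> r = 5"
    using n by auto
  have nkr: "n = 6 * k + r"
    by (simp add: k_def r_def)
  \<comment> \<open>The exponent is k*(3*k + r) with r odd, so one of its two factors is
    even.\<close>
  have "even (3 * k\<^sup>2 + k * r)"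
    using r by auto
  then obtain e where e: "3 * k\<^sup>2 + k * r = e * 2"
    by (metis evenE mult.commute)
  obtain b where b: "tate6_eds x r = b\<^sup>2" "b \<noteq> 0"
  proof (cases "r = 1")
    case True
    then have "tate6_eds x r = 1\<^sup>2"
      by (simp add: tate6_eds_def tate6_factor_def)
    then show ?thesis
      using that[of 1] by simp
  next
    case False
    then have "tate6_eds x r = (x ^ 5 * (x + 1) ^ 4)\<^sup>2"
      using r by (simp add: tate6_eds_def tate6_factor_def power_mult_distrib flip: power_mult)
    then show ?thesis
      using that[of "x ^ 5 * (x + 1) ^ 4"] x by simp
  qed
  define c where "c = tate6_multiplier x ^ e * b"
  have "c \<noteq> 0"
    using tate6_multiplier_nonzero[OF x] b by (simp add: c_def)
  moreover have "tate6_eds x n = (- 1) ^ k * c\<^sup>2"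
    unfolding nkr tate6_eds_quasi_periodic tate6_factor_def b(1) e c_def
    by (simp add: power_mult_distrib power_mult)
  \<comment> \<open>The leftover sign (-1)^k is absorbed by the convention that squares count up to
    sign.\<close>
  ultimately show ?thesis
    unfolding is_signed_square_def by (cases "even k") auto
qed

lemma tate6_eds_cube:
  assumes x: "x \<noteq> 0" "x \<noteq> - 1" and n: "n mod 18 \<in> {1, 3, 9, 15, 17}"
  shows "is_nonzero_cube (tate6_eds x n)"
proof -
  \<comment> \<open>Moving by 3*q periods makes the exponents of the multiplier and of -1 divisible
    by 3. Hence j stays reduced mod 18 only, and it suffices that the five values at j are
    cubes.\<close>
  define q j where "q = n div 18" and "j = n mod 18"
  have nqj: "n = 6 * (3 * q) + j"
    by (simp add: q_def j_def)
  have j: "j = 1 \<or> j = 3 \<or> j = 9 \<or> j = 15 \<or> j = 17"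
    using n by (simp add: j_def)
  have exponent: "3 * (3 * q)\<^sup>2 + 3 * q * j = (9 * q\<^sup>2 + q * j) * 3"
    by (simp add: power2_eq_square)
  obtain b where b: "tate6_eds x j = b ^ 3" "b \<noteq> 0"
  proof -
    \<comment> \<open>These are the cube roots of the tabulated values; the last branch is j =
      17.\<close>
    define b where "b = (if j = 1 then 1 else if j = 3 then - (x * (x + 1))
      else if j = 9 then x ^ 11 * (x + 1) ^ 9
      else if j = 15 then - (x ^ 31 * (x + 1) ^ 25) else x ^ 40 * (x + 1) ^ 32)"
    have "tate6_eds x j = b ^ 3"
      using j by (auto simp: b_def tate6_eds_values[OF refl] tate6_eds_values(2)[OF refl, simplified]
          power_mult_distrib simp flip: power_mult)
    moreover have "b \<noteq> 0"
      using x by (simp add: b_def)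
    ultimately show ?thesis
      using that by blast
  qed
  define c where "c = (- 1) ^ q * tate6_multiplier x ^ (9 * q\<^sup>2 + q * j) * b"
  have "c \<noteq> 0"
    using tate6_multiplier_nonzero[OF x] b by (simp add: c_def)
  moreover have "tate6_eds x n = c ^ 3"
    unfolding nqj tate6_eds_quasi_periodic tate6_factor_def b(1) exponent c_def
    by (simp only: power_mult_distrib power_mult[symmetric] mult.commute[of 3 q])
  ultimately show ?thesis
    unfolding is_nonzero_cube_def by blast
qed

section \<open>Identification with the given sequence\<close>

theorem theorem5p5:
  fixes \<alpha> :: int and h :: "nat \<Rightarrow> rat"
  assumes "\<alpha> \<notin> {-1, 0}"
    and "h 0 = 0"
    and "h 1 = 1"
    and "h 2 = of_int (- \<alpha> * (\<alpha> + 1))"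
    and "h 3 = of_int (- (\<alpha> ^ 3) * (\<alpha> + 1) ^ 3)"
    and "h 4 = of_int (\<alpha> ^ 6 * (\<alpha> + 1) ^ 5)"
    and "\<And>m. m \<ge> 2 \<Longrightarrow>
      h (2 * m + 1) = h (m + 2) * h m ^ 3 - h (m - 1) * h (m + 1) ^ 3"
    and "\<And>m. m \<ge> 3 \<Longrightarrow>
      h (2 * m) = h m * (h (m + 2) * h (m - 1) ^ 2 - h (m - 2) * h (m + 1) ^ 2) / h 2"
  shows "(\<forall>n. n mod 12 \<in> {1, 5, 7, 11} \<longrightarrow>
             (\<exists>k. h n = of_int k \<and> is_signed_square k))
       \<and> (\<forall>n. n mod 18 \<in> {1, 3, 9, 15, 17} \<longrightarrow>
             (\<exists>k. h n = of_int k \<and> is_nonzero_cube k))"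
proof -
  note init = assms(2-6) and odd_rec = assms(7) and even_rec = assms(8)
  have x: "\<alpha> \<noteq> 0" "\<alpha> \<noteq> - 1"
    using assms(1) by auto
  have start: "h n = of_int (tate6_eds \<alpha> n)" if "n < 5" for n
  proof -
    have "n = 0 \<or> n = 1 \<or> n = 2 \<or> n = 3 \<or> n = 4"
      using that by auto
    then show ?thesis
      using init by (auto simp: tate6_eds_def tate6_factor_def)
  qed
  \<comment> \<open>Division in the rationals is exact, so cancelling a nonzero \<open>h 2\<close>
    reduces the even recurrence to its multiplied form; integrality of h is then a
    consequence.\<close>
  have h2: "h 2 \<noteq> 0"
  proof -
    have "- \<alpha> * (\<alpha> + 1) \<noteq> 0"
      using x by simp
    then show ?thesis
      unfolding init(3) by (simp only: of_int_eq_0_iff not_False_eq_True)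
  qed
  have closed: "h n = of_int (tate6_eds \<alpha> n)" for n
  proof (induction n rule: less_induct)
    case (less n)
    \<comment> \<open>Beyond the initial values an even n = 2*m has m \<ge> 3 and an odd n = 2*m + 1
      has m \<ge> 2, exactly where the recurrences begin.\<close>
    consider "n < 5" | m where "m \<ge> 2" "n = 2 * m + 1" | m where "m \<ge> 3" "n = 2 * m"
    proof (cases "even n")
      case True
      then obtain m where "n = 2 * m" ..
      then show ?thesis
        using that(1) that(3)[of m] by linarith
    next
      case False
      then obtain m where "n = 2 * m + 1" ..
      then show ?thesis
        using that(1) that(2)[of m] by linarith
    qed
    then show ?case
    proof cases
      case 1
      then show ?thesis
        by (rule start)
    next
      case (2 m)
      then have IH: "h (m + 2) = of_int (tate6_eds \<alpha> (m + 2))" "h m = of_int (tate6_eds \<alpha> m)"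
        "h (m - 1) = of_int (tate6_eds \<alpha> (m - 1))" "h (m + 1) = of_int (tate6_eds \<alpha> (m + 1))"
        using less.IH by simp_all
      show ?thesis
        unfolding 2(2) odd_rec[OF 2(1)] IH tate6_eds_odd[OF 2(1)] by simp
    next
      case (3 m)
      then have IH: "h (m + 2) = of_int (tate6_eds \<alpha> (m + 2))" "h m = of_int (tate6_eds \<alpha> m)"
        "h (m - 1) = of_int (tate6_eds \<alpha> (m - 1))" "h (m + 1) = of_int (tate6_eds \<alpha> (m + 1))"
        "h (m - 2) = of_int (tate6_eds \<alpha> (m - 2))"
        using less.IH by simp_all
      have "m \<ge> 2"
        using 3 by simp
      have "h 2 * h (2 * m) = h m * (h (m + 2) * h (m - 1) ^ 2 - h (m - 2) * h (m + 1) ^ 2)"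
        using even_rec[OF 3(1)] h2 by simp
      also have "\<dots> = of_int (tate6_eds \<alpha> 2 * tate6_eds \<alpha> (2 * m))"
        unfolding IH tate6_eds_even[OF \<open>m \<ge> 2\<close>] by simp
      also have "\<dots> = h 2 * of_int (tate6_eds \<alpha> (2 * m))"
        using start[of 2] by simp
      finally show ?thesis
        using h2 3(2) by simp
    qed
  qed
  show ?thesis
    using closed tate6_eds_signed_square[OF x] tate6_eds_cube[OF x] by blast
qed

end
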